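(* Let $n\ge2$ be an integer and $c\in\mathbb{R}\setminus\{0\}$, with $n$ odd, or $n$ even and $c<0$. Let $k\in\mathbb{N}$ with $1\le k<n/2$, let $a_k=\cos(2k\pi/n)$, $b_k=\sin(2k\pi/n)$, and for $x\in\mathbb{R}$ let $$y_k^+(x)=\int_0^\infty e^{-(-c)^{n-1}\frac{w^n}{n}}\Bigl[e^{-cwx}-e^{-cwxa_k}\cos\Bigl(cwxb_k-\frac{2k\pi}{n}\Bigr)\Bigr]dw,$$ $$y_k^-(x)=-\int_0^\infty e^{-(-c)^{n-1}\frac{w^n}{n}-cwxa_k}\sin\Bigl(cwxb_k-\frac{2k\pi}{n}\Bigr)dw .$$ (a) Put $a_k^+=\cos\bigl(\frac{4k+1}{2n}\pi\bigr)$ and $b_k^+=\sin\bigl(\frac{4k+1}{2n}\pi\bigr)$. For every $x\in\mathbb{R}$ with $c\,a_k^+x\ge0$, $$y_k^+(x)=\int_0^\infty e^{-(-c)^{n-1}\frac{w^n}{n}-cwx}dw-\int_0^\infty e^{-cwxa_k^+}\cos\Bigl(cwxb_k^++(-c)^{n-1}\frac{w^n}{n}-\frac{4k+1}{2n}\pi\Bigr)dw,$$ $$y_k^-(x)=-\int_0^\infty e^{-cwxa_k^+}\sin\Bigl(cwxb_k^++(-c)^{n-1}\frac{w^n}{n}-\frac{4k+1}{2n}\pi\Bigr)dw.$$ (b) Put $a_k^-=\cos\bigl(\frac{4k-1}{2n}\pi\bigr)$ and $b_k^-=\sin\bigl(\frac{4k-1}{2n}\pi\bigr)$. For every $x\in\mathbb{R}$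 with $c\,a_k^-x\ge0$, $$y_k^+(x)=\int_0^\infty e^{-(-c)^{n-1}\frac{w^n}{n}-cwx}dw-\int_0^\infty e^{-cwxa_k^-}\cos\Bigl(cwxb_k^--(-c)^{n-1}\frac{w^n}{n}-\frac{4k-1}{2n}\pi\Bigr)dw,$$ $$y_k^-(x)=-\int_0^\infty e^{-cwxa_k^-}\sin\Bigl(cwxb_k^--(-c)^{n-1}\frac{w^n}{n}-\frac{4k-1}{2n}\pi\Bigr)dw.$$
   Context: Integrals over $(0,\infty)$ that are not absolutely convergent are understood as improper integrals $\lim_{R\to\infty}\int_0^R$. *)

theory Defs
  imports "HOL-Analysis.Analysis"
begin

definition improper_convergent :: "(real \<Rightarrow> real) \<Rightarrow> bool" where
  "improper_convergent f \<longleftrightarrow>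
     (\<forall>R>0. set_integrable lborel {0..R} f) \<and>
     (\<exists>L. ((\<lambda>R. LBINT w:{0..R}. f w) \<longlongrightarrow> L) at_top)"

text \<open>The value below is meaningful only for functions satisfying \<^const>\<open>improper_convergent\<close>.\<close>

definition improper_integral :: "(real \<Rightarrow> real) \<Rightarrow> real" where
  "improper_integral f = Lim at_top (\<lambda>R. LBINT w:{0..R}. f w)"

definition y_plus_integrand :: "nat \<Rightarrow> real \<Rightarrow> nat \<Rightarrow> real \<Rightarrow> real \<Rightarrow> real" where
  "y_plus_integrand n c k x w =
     (let \<theta> = 2 * real k * pi / real n; a = cos \<theta>; b = sin \<theta> in
      exp (- ((- c) ^ (n - 1) * (w ^ n / real n))) *
        (exp (- (c * w * x)) - exp (- (c * w * x * a)) * cos (c * w * x * b - \<theta>)))"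

definition y_minus_integrand :: "nat \<Rightarrow> real \<Rightarrow> nat \<Rightarrow> real \<Rightarrow> real \<Rightarrow> real" where
  "y_minus_integrand n c k x w =
     (let \<theta> = 2 * real k * pi / real n; a = cos \<theta>; b = sin \<theta> in
      exp (- ((- c) ^ (n - 1) * (w ^ n / real n)) - c * w * x * a) * sin (c * w * x * b - \<theta>))"

definition y_plus :: "nat \<Rightarrow> real \<Rightarrow> nat \<Rightarrow> real \<Rightarrow> real" where
  "y_plus n c k x = (LBINT w:{0<..}. y_plus_integrand n c k x w)"

definition y_minus :: "nat \<Rightarrow> real \<Rightarrow> nat \<Rightarrow> real \<Rightarrow> real" where
  "y_minus n c k x = - (LBINT w:{0<..}. y_minus_integrand n c k x w)"

end

theory Submission
  imports Defs "HOL-Complex_Analysis.Cauchy_Integral_Theorem"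
begin

text \<open>With \<open>A = (-c)^(n-1) / n > 0\<close>, \<open>B = c x\<close> and \<open>\<theta> = 2 k \<pi> / n\<close>, both \<open>y\<close>'s are read off the
  integral of \<open>F(z) = exp (-A z^n - B z)\<close> along the ray of argument \<open>\<theta>\<close>, where \<open>z^n\<close> is real. Turning
  the ray by \<open>s \<pi> / (2 n)\<close> with \<open>s = 1\<close> in (a) and \<open>s = -1\<close> in (b) makes \<open>z^n\<close> purely imaginary and
  gives the oscillating integrands. Since \<open>F\<close> has an entire primitive \<open>\<Phi>\<close>, the two truncated integrals
  differ by the increment of \<open>\<Phi>\<close> along an arc of radius \<open>R\<close>. At angular distance \<open>u\<close> from the turned ray,
  Jordan's inequality and the sign condition on \<open>x\<close> give \<open>|F| \<le> exp (-K u)\<close> with \<open>K\<close> of order \<open>R^n\<close>,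
  so the increment is at most \<open>R / K\<close>, which vanishes in the limit because \<open>n \<ge> 2\<close>.\<close>

section \<open>Elementary estimates, absolute integrability and improper integrals\<close>

lemma sin_ge_linear:
  fixes u :: real
  assumes "0 \<le> u" "u \<le> pi / 2"
  shows "2 * u / pi \<le> sin u"
proof -
  \<comment> \<open>Sine is concave on this interval, so it lies above the chord joining (0, 0) to
    (pi/2, 1).\<close>
  have "convex_on {0..pi/2} (\<lambda>x. - sin x :: real)"
  proof (rule f''_ge0_imp_convex)
    show "((\<lambda>x. - sin x) has_real_derivative - cos x) (at x)" for x :: real
      by (auto intro!: derivative_eq_intros)
    show "((\<lambda>x. - cos x) has_real_derivative sin x) (at x)" for x :: real
      by (auto intro!: derivative_eq_intros)
    show "0 \<le> sin x" if "x \<in> {0..pi/2}" for x :: real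
      using that by (intro sin_ge_zero) auto
  qed auto
  from convex_onD_Icc'[OF this, of u] assms show ?thesis
    by (simp add: field_simps)
qed

lemma abs_cos_diff_le: "\<bar>cos x - cos y\<bar> \<le> \<bar>x - y\<bar>" for x y :: real
proof -
  have "\<bar>cos x - cos y\<bar> = 2 * \<bar>sin ((x + y) / 2)\<bar> * \<bar>sin ((y - x) / 2)\<bar>"
    by (simp add: cos_diff_cos abs_mult)
  also have "\<dots> \<le> 2 * 1 * \<bar>(y - x) / 2\<bar>"
    by (intro mult_mono abs_sin_x_le_abs_x) auto
  finally show ?thesis by simp
qed

text \<open>For large \<open>w\<close> the power beats any linear term, so the exponent stays below
  \<open>C - w\<close> and a multiple of \<open>exp (- w)\<close> dominates.\<close>

lemma set_integrable_exp_power: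
  fixes A B :: real
  assumes "n \<ge> 2" "A > 0"
  shows "set_integrable lborel {0<..} (\<lambda>w. exp (- (A * w ^ n) + B * w))"
proof -
  \<comment> \<open>Beyond \<open>M\<close> one has \<open>A * w \<ge> \<bar>B\<bar> + 1\<close>,
    and \<open>M \<ge> 1\<close> gives \<open>w ^ 2 \<le> w ^ n\<close>; up to \<open>M\<close> the
    constant \<open>C\<close> covers the linear term. The extra 1 added to
    \<open>\<bar>B\<bar>\<close> is what leaves \<open>- w\<close> in the bound.\<close>
  define M where "M = max 1 ((\<bar>B\<bar> + 1) / A)"
  define C where "C = (\<bar>B\<bar> + 1) * M"
  have M: "M \<ge> 1" "A * M \<ge> \<bar>B\<bar> + 1"
    using assms by (auto simp: M_def field_simps max_def)
  have bound: "- (A * w ^ n) + B * w \<le> C - w" if "w > 0" for w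
  proof -
    have "(\<bar>B\<bar> + 1) * w \<le> A * w ^ n + C"
    proof (cases "w \<le> M")
      case True
      then have "(\<bar>B\<bar> + 1) * w \<le> C" by (simp add: C_def mult_left_mono)
      moreover have "A * w ^ n \<ge> 0" using assms that by simp
      ultimately show ?thesis by linarith
    next
      case False
      have "w ^ 2 \<le> w ^ n"
        using False M assms by (intro power_increasing) auto
      have "(\<bar>B\<bar> + 1) * w \<le> (A * M) * w" using M that by (intro mult_right_mono) auto
      also have "\<dots> \<le> (A * w) * w" using False that assms by (intro mult_right_mono mult_left_mono) auto
      also have "\<dots> = A * w ^ 2" by (simp add: power2_eq_square)
      also have "\<dots> \<le> A * w ^ n" using \<open>w ^ 2 \<le> w ^ n\<close> assms by simp
      finally show ?thesis using M by (simp add: C_def add_increasing2)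
    qed
    moreover have "B * w \<le> \<bar>B\<bar> * w" using that by (simp add: mult_right_mono)
    ultimately show ?thesis by (simp add: algebra_simps)
  qed
  have "(\<lambda>w::real. exp (- 1 * w)) absolutely_integrable_on {0..}"
    by (intro nonnegative_absolutely_integrable_1 integrable_on_exp_minus_to_infinity) auto
  then have "set_integrable lborel {0..} (\<lambda>w::real. exp (- w))"
    unfolding set_integrable_def by (subst (asm) integrable_completion) auto
  then have "set_integrable lborel {0<..} (\<lambda>w::real. exp (- w))"
    by (rule set_integrable_subset) auto
  then have "set_integrable lborel {0<..} (\<lambda>w::real. exp C * exp (- w))"
    by (rule set_integrable_mult_right)
  then show ?thesis
  proof (rule set_integrable_bound)
    show "set_borel_measurable lborel {0<..} (\<lambda>w. exp (- (A * w ^ n) + B * w))"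
      unfolding set_borel_measurable_def by measurable
    show "AE w in lborel. w \<in> {0<..} \<longrightarrow>
        norm (exp (- (A * w ^ n) + B * w)) \<le> norm (exp C * exp (- w))"
      using bound by (simp flip: exp_add)
  qed
qed

text \<open>Splits one complex limit into the real cosine and sine integrals. Continuity supplies
  integrability on each \<open>{0..R}\<close>, so only the limit itself has to be provided.\<close>

lemma improper_integral_Re_Im:
  fixes g :: "real \<Rightarrow> complex"
  assumes cont: "continuous_on UNIV g"
    and lim: "((\<lambda>R. LBINT w:{0..R}. g w) \<longlongrightarrow> L) at_top"
  shows "improper_convergent (\<lambda>w. Re (g w))" "improper_integral (\<lambda>w. Re (g w)) = Re L"
    "improper_convergent (\<lambda>w. Im (g w))" "improper_integral (\<lambda>w. Im (g w)) = Im L"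
proof -
  have int: "set_integrable lborel {0..R} g" for R
    by (rule borel_integrable_atLeastAtMost') (rule continuous_on_subset[OF cont], simp)
  have intRe: "set_integrable lborel {0..R} (\<lambda>w. Re (g w))"
    and intIm: "set_integrable lborel {0..R} (\<lambda>w. Im (g w))" for R
    by (intro borel_integrable_atLeastAtMost' continuous_intros continuous_on_subset[OF cont]; simp)+
  have "(LBINT w:{0..R}. Re (g w)) = Re (LBINT w:{0..R}. g w)"
    and "(LBINT w:{0..R}. Im (g w)) = Im (LBINT w:{0..R}. g w)" for R
    using int[of R] unfolding set_integrable_def set_lebesgue_integral_def
    by (simp_all flip: integral_Re integral_Im)
  then have "((\<lambda>R. LBINT w:{0..R}. Re (g w)) \<longlongrightarrow> Re L) at_top"
    and "((\<lambda>R. LBINT w:{0..R}. Im (g w)) \<longlongrightarrow> Im L) at_top"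
    using tendsto_Re[OF lim] tendsto_Im[OF lim] by simp_all
  then show "improper_convergent (\<lambda>w. Re (g w))" "improper_integral (\<lambda>w. Re (g w)) = Re L"
    "improper_convergent (\<lambda>w. Im (g w))" "improper_integral (\<lambda>w. Im (g w)) = Im L"
    using intRe intIm unfolding improper_convergent_def improper_integral_def
    by (auto intro!: tendsto_Lim)
qed

section \<open>Integrals along rays from the origin\<close>

text \<open>The trailing factor \<open>cis \<alpha>\<close> is dz/dw for z = w
  \<open>cis \<alpha>\<close>, so integrating over \<open>{0..R}\<close> gives the contour integral
  along a segment of the ray.\<close>

definition ray_integrand :: "nat \<Rightarrow> real \<Rightarrow> real \<Rightarrow> real \<Rightarrow> real \<Rightarrow> complex" where
  "ray_integrand n A B \<alpha> w =
     exp (- (of_real A * (of_real w * cis \<alpha>) ^ n) - of_real B * (of_real w * cis \<alpha>)) * cis \<alpha>"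

lemma continuous_on_ray_integrand: "continuous_on S (ray_integrand n A B \<alpha>)"
  unfolding ray_integrand_def by (intro continuous_intros)

text \<open>De Moivre's formula gives modulus and phase; the factor \<open>cis \<alpha>\<close> only
  shifts the phase. The minus sign is pulled out so that the bracket has the form of the arguments
  of the cosines and sines in the theorem.\<close>

lemma ray_integrand_eq:
  "ray_integrand n A B \<alpha> w =
     rcis (exp (- (A * w ^ n * cos (real n * \<alpha>)) - B * w * cos \<alpha>))
       (- (B * w * sin \<alpha> + A * w ^ n * sin (real n * \<alpha>) - \<alpha>))"
proof -
  have "- (of_real A * (of_real w * cis \<alpha>) ^ n) - of_real B * (of_real w * cis \<alpha>) + \<i> * of_real \<alpha> =
      Complex (- (A * w ^ n * cos (real n * \<alpha>)) - B * w * cos \<alpha>)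
        (- (B * w * sin \<alpha> + A * w ^ n * sin (real n * \<alpha>) - \<alpha>))"
    by (simp add: power_mult_distrib Complex.DeMoivre complex_eq_iff flip: of_real_power of_real_mult)
  then show ?thesis
    unfolding ray_integrand_def cis_conv_exp[of \<alpha>] exp_add[symmetric]
    by (simp only: exp_eq_polar complex.sel rcis_def)
qed

text \<open>The conclusion is a limit, while absolute integrability is asked only on the ray
  \<theta>: on the ray \<phi> the modulus is \<open>exp (- (B * w * cos \<phi>))\<close>, which does
  not decay at all when \<open>B * cos \<phi> = 0\<close>.\<close>

lemma rotate_ray:
  fixes n k :: nat and A B s \<theta> \<phi> :: real
  assumes n: "n \<ge> 2" and A: "A > 0" and s: "s = 1 \<or> s = -1"
    and \<theta>: "\<theta> = 2 * real k * pi / real n" and \<phi>: "\<phi> = \<theta> + s * (pi / (2 * real n))"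
    and B: "B * cos \<phi> \<ge> 0"
    and int: "set_integrable lborel {0<..} (ray_integrand n A B \<theta>)"
  shows "((\<lambda>R. LBINT w:{0..R}. ray_integrand n A B \<phi> w) \<longlongrightarrow>
            (LBINT w:{0<..}. ray_integrand n A B \<theta> w)) at_top"
proof -
  define F :: "complex \<Rightarrow> complex"
    where "F = (\<lambda>z. exp (- (of_real A * z ^ n) - of_real B * z))"
  have ri: "ray_integrand n A B \<alpha> w = F (of_real w * cis \<alpha>) * cis \<alpha>" for \<alpha> w
    by (simp add: ray_integrand_def F_def)
  have "F holomorphic_on UNIV"
    unfolding F_def by (intro holomorphic_intros)
  then obtain \<Phi> where \<Phi>: "\<And>z. (\<Phi> has_field_derivative F z) (at z)"
    using holomorphic_convex_primitive'[OF convex_UNIV open_UNIV, of F] by (metis UNIV_I)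
  have FTC: "(LBINT w:{0..R}. ray_integrand n A B \<alpha> w) = \<Phi> (of_real R * cis \<alpha>) - \<Phi> 0"
    if "R \<ge> 0" for R \<alpha>
  proof -
    have "(\<integral>w. indicator {0..R} w *\<^sub>R ray_integrand n A B \<alpha> w \<partial>lborel) =
        \<Phi> (of_real R * cis \<alpha>) - \<Phi> (of_real 0 * cis \<alpha>)"
    proof (rule integral_FTC_atLeastAtMost[OF that])
      fix w :: real
      have "((\<lambda>z. z * cis \<alpha>) has_field_derivative cis \<alpha>) (at (of_real w))"
        by (auto intro!: derivative_eq_intros)
      then have "((\<lambda>z. \<Phi> (z * cis \<alpha>)) has_field_derivative F (of_real w * cis \<alpha>) * cis \<alpha>) (at (of_real w))"
        by (rule DERIV_chain2[OF \<Phi>])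
      then show "((\<lambda>w. \<Phi> (of_real w * cis \<alpha>)) has_vector_derivative ray_integrand n A B \<alpha> w)
          (at w within {0..R})"
        unfolding ri by (rule has_vector_derivative_real_field)
    qed (rule continuous_on_ray_integrand)
    then show ?thesis by (simp add: set_lebesgue_integral_def)
  qed
  define T where "T = pi / (2 * real n)"
  \<comment> \<open>\<open>T\<close> is the angle between the rays, and \<open>t\<close> is measured
    from \<theta>, so \<open>T - t\<close> is the distance to the turned ray. \<open>K R\<close> is
    the decay rate per unit of that distance: Jordan's gain from the power minus the possible loss
    from the linear term.\<close>
  define K where "K = (\<lambda>R. 2 * A / pi * R ^ n - \<bar>B\<bar> * R)"
  have T: "T > 0" "real n * T = pi / 2" using n by (auto simp: T_def)
  have norm_F: "norm (F (of_real R * cis (\<theta> + s * t))) \<le> exp (- (K R * (T - t)))"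
    if R: "R > 0" and t: "0 \<le> t" "t \<le> T" for R t
  proof -
    let ?\<alpha> = "\<theta> + s * t"
    \<comment> \<open>Periodicity removes \<theta> and evenness of cosine removes \<open>s\<close>,
      so both directions of rotation are treated at once. Since \<open>real n * T = pi / 2\<close>,
      the cosine becomes a sine of the distance to the turned ray.\<close>
    have "real n * ?\<alpha> = real n * t * s + 2 * real k * pi"
      using n by (simp add: \<theta> field_simps)
    then have "cos (real n * ?\<alpha>) = cos (real n * t * s)"
      by (simp add: cos_add)
    also have "\<dots> = cos (real n * t)" using s by auto
    also have "\<dots> = sin (real n * (T - t))"
      unfolding right_diff_distrib T(2) sin_diff by simp
    also have "\<dots> \<ge> 2 * (real n * (T - t)) / pi"
      using T t by (intro sin_ge_linear) (auto simp: right_diff_distrib mult_left_mono)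
    finally have 1: "2 / pi * (T - t) \<le> cos (real n * ?\<alpha>)"
    proof -
      assume *: "2 * (real n * (T - t)) / pi \<le> cos (real n * ?\<alpha>)"
      have "1 * (2 / pi * (T - t)) \<le> real n * (2 / pi * (T - t))"
        using n t by (intro mult_right_mono) auto
      also have "\<dots> = 2 * (real n * (T - t)) / pi" by simp
      finally show ?thesis using * by linarith
    qed
    \<comment> \<open>The linear term is harmless at \<phi> by the sign condition on
      \<open>B\<close>; elsewhere on the arc the Lipschitz bound makes its loss proportional to
      \<open>T - t\<close>, so the power term can absorb it.\<close>
    have "\<bar>cos \<phi> - cos ?\<alpha>\<bar> \<le> \<bar>\<phi> - ?\<alpha>\<bar>" by (rule abs_cos_diff_le)
    also have "\<dots> = T - t" using s t by (auto simp: \<phi> T_def)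
    finally have "\<bar>B\<bar> * \<bar>cos \<phi> - cos ?\<alpha>\<bar> \<le> \<bar>B\<bar> * (T - t)"
      by (rule mult_left_mono) simp
    then have "B * cos \<phi> - B * cos ?\<alpha> \<le> \<bar>B\<bar> * (T - t)"
      by (metis abs_le_D1 abs_mult order_trans right_diff_distrib)
    with B have "- (B * cos ?\<alpha>) \<le> \<bar>B\<bar> * (T - t)" by linarith
    then have 2: "- (B * R * cos ?\<alpha>) \<le> \<bar>B\<bar> * R * (T - t)"
      using mult_left_mono[of "- (B * cos ?\<alpha>)" "\<bar>B\<bar> * (T - t)" R] R by (simp add: mult_ac)
    have 3: "A * R ^ n * (2 / pi * (T - t)) \<le> A * R ^ n * cos (real n * ?\<alpha>)"
      using A R by (intro mult_left_mono[OF 1]) auto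
    have "norm (F (of_real R * cis ?\<alpha>)) = norm (ray_integrand n A B ?\<alpha> R)"
      by (simp add: ri norm_mult)
    also have "\<dots> = exp (- (A * R ^ n * cos (real n * ?\<alpha>)) - B * R * cos ?\<alpha>)"
      by (simp add: ray_integrand_eq norm_mult)
    also have "\<dots> \<le> exp (- (K R * (T - t)))"
      using 2 3 by (simp add: K_def algebra_simps)
    finally show ?thesis .
  qed
  have arc: "norm (\<Phi> (of_real R * cis \<phi>) - \<Phi> (of_real R * cis \<theta>)) \<le> R / K R"
    if R: "R > 0" and K: "K R > 0" for R
  proof -
    let ?h = "\<lambda>t. \<Phi> (of_real R * cis (\<theta> + s * t))"
    let ?h' = "\<lambda>t. F (of_real R * cis (\<theta> + s * t)) * (of_real R * (of_real s * (\<i> * cis (\<theta> + s * t))))"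
    have h': "(?h has_vector_derivative ?h' t) (at t)" for t
    proof -
      have "((\<lambda>t. of_real R * cis (\<theta> + s * t)) has_vector_derivative
          of_real R * (of_real s * (\<i> * cis (\<theta> + s * t)))) (at t)"
      proof -
        have "((\<lambda>z. of_real R * exp (\<i> * (of_real \<theta> + of_real s * z))) has_field_derivative
            of_real R * (of_real s * (\<i> * cis (\<theta> + s * t)))) (at (of_real t))"
          by (auto intro!: derivative_eq_intros simp: cis_conv_exp)
        from has_vector_derivative_real_field[OF this] show ?thesis
          by (simp add: cis_conv_exp)
      qed
      from field_vector_diff_chain_at[OF this \<Phi>] show ?thesis
        by (simp add: o_def mult_ac)
    qed
    \<comment> \<open>Mean value inequality with an explicit majorant: its derivative
      \<open>R * exp (- (K R * (T - t)))\<close> is the bound on the speed of \<open>?h\<close>,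
      where the factor \<open>R\<close> comes from the arc.\<close>
    have "norm (?h T - ?h 0) \<le> R / K R * exp (- (K R * (T - T))) - R / K R * exp (- (K R * (T - 0)))"
    proof (rule differentiable_bound_general[OF T(1)])
      show "continuous_on {0..T} ?h"
        by (intro continuous_at_imp_continuous_on ballI has_vector_derivative_continuous[OF h'])
      show "continuous_on {0..T} (\<lambda>t. R / K R * exp (- (K R * (T - t))))"
        by (intro continuous_intros)
      show "(?h has_vector_derivative ?h' t) (at t)" for t by (rule h')
      show "((\<lambda>t. R / K R * exp (- (K R * (T - t)))) has_vector_derivative
          R * exp (- (K R * (T - t)))) (at t)" for t
        unfolding has_real_derivative_iff_has_vector_derivative[symmetric]
        using K by (auto intro!: derivative_eq_intros)
      show "norm (?h' t) \<le> R * exp (- (K R * (T - t)))" if "0 < t" "t < T" for t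
        using norm_F[of R t] that R s by (auto simp: norm_mult)
    qed
    also have "\<dots> \<le> R / K R" using R K by simp
    finally show ?thesis by (simp add: \<phi> T_def)
  qed
  have K_at_top: "filterlim (\<lambda>R. 2 * A / pi * R - \<bar>B\<bar>) at_top at_top"
  proof -
    have "filterlim (\<lambda>R. - \<bar>B\<bar> + 2 * A / pi * R) at_top at_top"
      using A by (intro filterlim_tendsto_add_at_top[OF tendsto_const]
          filterlim_tendsto_pos_mult_at_top[OF tendsto_const _ filterlim_ident]) simp
    then show ?thesis by simp
  qed
  have "((\<lambda>R. \<Phi> (of_real R * cis \<phi>) - \<Phi> (of_real R * cis \<theta>)) \<longlongrightarrow> 0) at_top"
  proof (rule Lim_null_comparison)
    \<comment> \<open>This comparison function is \<open>R / K R\<close> with \<open>R ^ n\<close>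
      lowered to \<open>R ^ 2\<close>, which is allowed for \<open>R \<ge> 1\<close> because
      \<open>n \<ge> 2\<close>.\<close>
    show "((\<lambda>R. inverse (2 * A / pi * R - \<bar>B\<bar>)) \<longlongrightarrow> 0) at_top"
      by (rule tendsto_inverse_0_at_top[OF K_at_top])
    show "\<forall>\<^sub>F R in at_top. norm (\<Phi> (of_real R * cis \<phi>) - \<Phi> (of_real R * cis \<theta>))
        \<le> inverse (2 * A / pi * R - \<bar>B\<bar>)"
      using eventually_ge_at_top[of 1] filterlim_at_top_dense[THEN iffD1, OF K_at_top, rule_format, of 0]
    proof eventually_elim
      case (elim R)
      have "R ^ 2 \<le> R ^ n" using n elim by (intro power_increasing) auto
      then have "2 * A / pi * R ^ 2 \<le> 2 * A / pi * R ^ n"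
        using A by (intro mult_left_mono) auto
      then have K: "R * (2 * A / pi * R - \<bar>B\<bar>) \<le> K R"
        by (simp add: K_def algebra_simps power2_eq_square)
      have pos: "0 < R * (2 * A / pi * R - \<bar>B\<bar>)" using elim by simp
      have "norm (\<Phi> (of_real R * cis \<phi>) - \<Phi> (of_real R * cis \<theta>)) \<le> R / K R"
        using elim order_less_le_trans[OF pos K] by (intro arc) auto
      also have "\<dots> \<le> R / (R * (2 * A / pi * R - \<bar>B\<bar>))"
        using elim K pos order_less_le_trans[OF pos K] by (intro divide_left_mono mult_pos_pos) auto
      also have "\<dots> = inverse (2 * A / pi * R - \<bar>B\<bar>)"
        using elim by (simp add: field_simps)
      finally show ?case .
    qed
  qed
  then have diff: "((\<lambda>R. (LBINT w:{0..R}. ray_integrand n A B \<phi> w) -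
      (LBINT w:{0..R}. ray_integrand n A B \<theta> w)) \<longlongrightarrow> 0) at_top"
    by (rule Lim_transform_eventually)
      (use eventually_ge_at_top[of 0] in eventually_elim, simp add: FTC)
  \<comment> \<open>The truncated integrals converge to the integral over the closed half-line,
    which differs from the open one by a null set.\<close>
  have null: "AE w in lborel. indicator {0..} w *\<^sub>R ray_integrand n A B \<theta> w =
      indicator {0<..} w *\<^sub>R ray_integrand n A B \<theta> w"
    using AE_lborel_singleton[of 0] by eventually_elim (auto simp: indicator_def)
  have "set_integrable lborel {0..} (ray_integrand n A B \<theta>)"
    using int unfolding set_integrable_def
    by (subst integrable_cong_AE[OF _ _ null])
      (auto intro!: borel_measurable_continuous_on_indicator continuous_on_ray_integrand)
  then have "((\<lambda>R. LBINT w:{0..R}. ray_integrand n A B \<theta> w) \<longlongrightarrow>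
      (LBINT w:{0..}. ray_integrand n A B \<theta> w)) at_top"
    by (intro tendsto_set_lebesgue_integral_at_top) auto
  also have "(LBINT w:{0..}. ray_integrand n A B \<theta> w) = (LBINT w:{0<..}. ray_integrand n A B \<theta> w)"
    unfolding set_lebesgue_integral_def
    by (intro integral_cong_AE null)
      (auto intro!: borel_measurable_continuous_on_indicator continuous_on_ray_integrand)
  finally show ?thesis by (rule Lim_transform[OF _ diff])
qed

section \<open>The two rotated representations\<close>

theorem mainTheorem3:
  fixes n k :: nat and c \<phi>p ap bp \<phi>m am bm :: real
  assumes "n \<ge> 2" and "c \<noteq> 0"
    and "odd n \<or> (even n \<and> c < 0)"
    and "1 \<le> k" and "real k < real n / 2"
    and "\<phi>p = (4 * real k + 1) / (2 * real n) * pi"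
    and "ap = cos \<phi>p" and "bp = sin \<phi>p"
    and "\<phi>m = (4 * real k - 1) / (2 * real n) * pi"
    and "am = cos \<phi>m" and "bm = sin \<phi>m"
  shows
    "(\<forall>x. set_integrable lborel {0<..} (y_plus_integrand n c k x)
        \<and> set_integrable lborel {0<..} (y_minus_integrand n c k x)
        \<and> set_integrable lborel {0<..}
            (\<lambda>w. exp (- ((- c) ^ (n - 1) * (w ^ n / real n)) - c * w * x)))
     \<and>
     (\<forall>x. c * ap * x \<ge> 0 \<longrightarrow>
        improper_convergent
          (\<lambda>w. exp (- (c * w * x * ap)) *
               cos (c * w * x * bp + (- c) ^ (n - 1) * (w ^ n / real n) - \<phi>p))
        \<and> y_plus n c k x =
            (LBINT w:{0<..}. exp (- ((- c) ^ (n - 1) * (w ^ n / real n)) - c * w * x))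
            - improper_integral
                (\<lambda>w. exp (- (c * w * x * ap)) *
                     cos (c * w * x * bp + (- c) ^ (n - 1) * (w ^ n / real n) - \<phi>p))
        \<and> improper_convergent
          (\<lambda>w. exp (- (c * w * x * ap)) *
               sin (c * w * x * bp + (- c) ^ (n - 1) * (w ^ n / real n) - \<phi>p))
        \<and> y_minus n c k x =
            - improper_integral
                (\<lambda>w. exp (- (c * w * x * ap)) *
                     sin (c * w * x * bp + (- c) ^ (n - 1) * (w ^ n / real n) - \<phi>p)))
     \<and>
     (\<forall>x. c * am * x \<ge> 0 \<longrightarrow>
        improper_convergent
          (\<lambda>w. exp (- (c * w * x * am)) *
               cos (c * w * x * bm - (- c) ^ (n - 1) * (w ^ n / real n) - \<phi>m))
        \<and> y_plus n c k x =
            (LBINT w:{0<..}. exp (- ((- c) ^ (n - 1) * (w ^ n / real n)) - c * w * x))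
            - improper_integral
                (\<lambda>w. exp (- (c * w * x * am)) *
                     cos (c * w * x * bm - (- c) ^ (n - 1) * (w ^ n / real n) - \<phi>m))
        \<and> improper_convergent
          (\<lambda>w. exp (- (c * w * x * am)) *
               sin (c * w * x * bm - (- c) ^ (n - 1) * (w ^ n / real n) - \<phi>m))
        \<and> y_minus n c k x =
            - improper_integral
                (\<lambda>w. exp (- (c * w * x * am)) *
                     sin (c * w * x * bm - (- c) ^ (n - 1) * (w ^ n / real n) - \<phi>m)))"
proof -
  define A where "A = (- c) ^ (n - 1) / real n"
  define \<theta> where "\<theta> = 2 * real k * pi / real n"
  have n: "n \<ge> 2" by fact
  have n0: "real n > 0" using n by simp
  \<comment> \<open>For odd \<open>n\<close> the exponent is even and \<open>c \<noteq> 0\<close>;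
    for even \<open>n\<close> the base is positive.\<close>
  have "(- c) ^ (n - 1) > 0"
    using assms(1-3) by (auto simp: zero_less_power_eq)
  then have A: "A > 0" using n0 by (simp add: A_def)
  have A_eq: "(- c) ^ (n - 1) * (w ^ n / real n) = A * w ^ n" for w
    by (simp add: A_def)
  have n\<theta>: "real n * \<theta> = 2 * real k * pi" using n0 by (simp add: \<theta>_def)
  have cos_n\<theta>: "cos (real n * \<theta>) = 1" and sin_n\<theta>: "sin (real n * \<theta>) = 0"
    unfolding n\<theta> by simp_all
  define g where "g = (\<lambda>x. ray_integrand n A (c * x) \<theta>)"
  define e where "e = (\<lambda>x w. exp (- (A * w ^ n) - c * w * x))"
  have g_eq: "g x w = rcis (exp (- (A * w ^ n) - c * w * x * cos \<theta>)) (- (c * w * x * sin \<theta> - \<theta>))"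
    for x w
    unfolding g_def ray_integrand_eq cos_n\<theta> sin_n\<theta> by (simp add: mult_ac)
  have plus_eq: "y_plus_integrand n c k x w = e x w - Re (g x w)" for x w
    unfolding y_plus_integrand_def Let_def A_eq \<theta>_def[symmetric] g_eq e_def
      Re_rcis cos_minus
    by (simp add: exp_diff exp_minus field_simps)
  have minus_eq: "y_minus_integrand n c k x w = - Im (g x w)" for x w
    unfolding y_minus_integrand_def Let_def A_eq \<theta>_def[symmetric] g_eq
      Im_rcis sin_minus by simp
  have int_e: "set_integrable lborel {0<..} (e x)" for x
    using set_integrable_exp_power[OF n A, of "- c * x"] by (simp add: e_def mult_ac)
  have int_g: "set_integrable lborel {0<..} (g x)" for x
  proof (rule set_integrable_bound[OF set_integrable_exp_power[OF n A, of "- c * x * cos \<theta>"]])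
    show "set_borel_measurable lborel {0<..} (g x)"
      unfolding set_borel_measurable_def g_def
      by (simp add: borel_measurable_continuous_on_indicator continuous_on_ray_integrand)
    show "AE w in lborel. w \<in> {0<..} \<longrightarrow>
        norm (g x w) \<le> norm (exp (- (A * w ^ n) + - c * x * cos \<theta> * w))"
      by (simp add: g_eq norm_mult mult_ac)
  qed
  have int_Re: "set_integrable lborel {0<..} (\<lambda>w. Re (g x w))"
    and int_Im: "set_integrable lborel {0<..} (\<lambda>w. Im (g x w))"
    for x
    using integrable_Re[OF int_g[of x, unfolded set_integrable_def]]
      integrable_Im[OF int_g[of x, unfolded set_integrable_def]]
    unfolding set_integrable_def by simp_all
  have Re_int: "(LBINT w:{0<..}. Re (g x w)) = Re (LBINT w:{0<..}. g x w)"
    and Im_int: "(LBINT w:{0<..}. Im (g x w)) = Im (LBINT w:{0<..}. g x w)" for x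
    using integral_Re[OF int_g[of x, unfolded set_integrable_def]]
      integral_Im[OF int_g[of x, unfolded set_integrable_def]]
    unfolding set_lebesgue_integral_def by simp_all
  have plus: "y_plus n c k x = (LBINT w:{0<..}. e x w) - Re (LBINT w:{0<..}. g x w)" for x
    unfolding y_plus_def plus_eq by (simp add: set_integral_diff(2)[OF int_e int_Re] Re_int)
  \<comment> \<open>The minus sign in \<open>y_minus\<close> cancels the one from the negated phase
    of \<open>g\<close>.\<close>
  have minus: "y_minus n c k x = Im (LBINT w:{0<..}. g x w)" for x
    unfolding y_minus_def minus_eq Im_int[symmetric] by (simp add: set_lebesgue_integral_def)
  \<comment> \<open>Parts (a) and (b) are the instances \<open>s = 1\<close> and
    \<open>s = - 1\<close>.\<close>
  have rotated:
    "improper_convergent (\<lambda>w. exp (- (c * w * x * cos \<phi>)) * cos (c * w * x * sin \<phi> + s * (A * w ^ n) - \<phi>))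
      \<and> y_plus n c k x = (LBINT w:{0<..}. e x w) - improper_integral
          (\<lambda>w. exp (- (c * w * x * cos \<phi>)) * cos (c * w * x * sin \<phi> + s * (A * w ^ n) - \<phi>))
      \<and> improper_convergent (\<lambda>w. exp (- (c * w * x * cos \<phi>)) * sin (c * w * x * sin \<phi> + s * (A * w ^ n) - \<phi>))
      \<and> y_minus n c k x = - improper_integral
          (\<lambda>w. exp (- (c * w * x * cos \<phi>)) * sin (c * w * x * sin \<phi> + s * (A * w ^ n) - \<phi>))"
    if s: "s = 1 \<or> s = - 1" and \<phi>: "\<phi> = \<theta> + s * (pi / (2 * real n))" and x: "c * cos \<phi> * x \<ge> 0"
    for s \<phi> x
  proof -
    let ?g = "ray_integrand n A (c * x) \<phi>"
    \<comment> \<open>At this angle \<open>A * w ^ n\<close> leaves the modulus and enters the phase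
      with sign \<open>s\<close>.\<close>
    have "real n * \<phi> = s * (pi / 2) + 2 * real k * pi"
      using n0 by (simp add: \<phi> \<theta>_def field_simps)
    then have trig: "cos (real n * \<phi>) = 0" "sin (real n * \<phi>) = s"
      using s by (auto simp: cos_add sin_add)
    have g_\<phi>: "?g w = rcis (exp (- (c * w * x * cos \<phi>)))
        (- (c * w * x * sin \<phi> + s * (A * w ^ n) - \<phi>))" for w
      unfolding ray_integrand_eq trig by (simp add: mult_ac)
    have Re_g: "(\<lambda>w. Re (?g w)) =
        (\<lambda>w. exp (- (c * w * x * cos \<phi>)) * cos (c * w * x * sin \<phi> + s * (A * w ^ n) - \<phi>))"
      unfolding g_\<phi> by (simp only: Re_rcis cos_minus)
    have Im_g: "(\<lambda>w. Im (cnj (?g w))) =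
        (\<lambda>w. exp (- (c * w * x * cos \<phi>)) * sin (c * w * x * sin \<phi> + s * (A * w ^ n) - \<phi>))"
      unfolding g_\<phi>
      by (simp only: Im_rcis cnj.sel sin_minus mult_minus_right minus_minus)
    have lim: "((\<lambda>R. LBINT w:{0..R}. ?g w) \<longlongrightarrow> (LBINT w:{0<..}. g x w)) at_top"
      unfolding g_def using x
      by (intro rotate_ray[OF n A s \<theta>_def \<phi>] int_g[unfolded g_def]) (simp_all add: mult_ac)
    \<comment> \<open>The sine integral is minus the imaginary part of the ray integral, hence the conjugate.\<close>
    have lim_cnj: "((\<lambda>R. LBINT w:{0..R}. cnj (?g w)) \<longlongrightarrow> cnj (LBINT w:{0<..}. g x w)) at_top"
    proof -
      have "(LBINT w:{0..R}. cnj (?g w)) = cnj (LBINT w:{0..R}. ?g w)" for R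
        unfolding set_lebesgue_integral_def Bochner_Integration.integral_cnj[symmetric] by simp
      with tendsto_cnj[OF lim] show ?thesis by simp
    qed
    note Re = improper_integral_Re_Im(1,2)[OF continuous_on_ray_integrand lim, unfolded Re_g]
    have "continuous_on UNIV (\<lambda>w. cnj (?g w))"
      by (intro continuous_intros continuous_on_ray_integrand)
    note Im = improper_integral_Re_Im(3,4)[OF this lim_cnj, unfolded Im_g]
    show ?thesis using Re Im by (simp add: plus minus)
  qed
  have \<phi>p: "\<phi>p = \<theta> + 1 * (pi / (2 * real n))" and \<phi>m: "\<phi>m = \<theta> + (- 1) * (pi / (2 * real n))"
    using n0 by (simp_all add: assms(6,9) \<theta>_def field_simps)
  show ?thesis
    unfolding A_eq assms(7,8,10,11)
    using rotated[OF _ \<phi>p] rotated[OF _ \<phi>m] int_e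
      set_integral_diff(1)[OF int_e int_Re] int_Im
    by (simp add: plus_eq[abs_def] minus_eq[abs_def] e_def set_integrable_def)
qed

end
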